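(* Let $\mathcal{A}$ be a finitely generated structure. The following are equivalent: (1) $\mathcal{A}$ has a finitely generated $\Sigma^0_1$-elementary substructure $\mathcal{B}$ with $\mathcal{B}\not\cong\mathcal{A}$ such that $\mathcal{B}$ contains a $\Sigma^0_1$-elementary substructure isomorphic to $\mathcal{A}$; (2) $\mathrm{Th}_2(\mathcal{A})$ is not quasi-categorical.
   Context: Formulas are in $\mathcal{L}_{\omega_1\omega}$ with the hierarchy: $\Sigma^0_0=\Pi^0_0$ = finitary quantifier-free; $\Sigma^0_\alpha$ = countable disjunctions of $\exists\bar x\,\phi$ with $\phi\in\Pi^0_\beta$, $\beta<\alpha$; $\Pi^0_\alpha$ = countable conjunctions of $\forall\bar x\,\phi$ with $\phi\in\Sigma^0_\beta$, $\beta<\alpha$. A substructure $\mathcal{B}\subseteq\mathcal{C}$ is $\Sigma^0_1$-elementary if every $\Sigma^0_1$ formula with parameters from $\mathcal{B}$ true in $\mathcal{C}$ is true in $\mathcal{B}$. The 2-theory $\mathrm{Th}_2(\mathcal{A})$ is the set of $\Sigma^0_2$ and $\Pi^0_2$ sentences true in $\mathcal{A}$. For finitely generated $\mathcal{A}$, $\mathrm{Th}_2(\mathcal{A})$ is quasi-categorical if $\mathcal{A}$ is, up to isomorphism, the only finitely generated model of $\mathrm{Th}_2(\mathcal{A})$.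
   Formalization: The language is assumed countable, the usual convention for L_{ω1ω}; the English does not say so, and over an uncountable language a finitely generated A can have Th_2(A) not quasi-categorical while (1) fails. *)

theory Defs
  imports Main "HOL-Library.Countable_Set"
begin

section \<open>Languages and structures\<close>

text \<open>The symbols are sets rather than whole types, so that a language may lack function or
  relation symbols altogether. Constants are function symbols of arity 0.\<close>

record ('f, 'r) lang =
  Funs :: "'f set"
  Rels :: "'r set"
  far :: "'f \<Rightarrow> nat"
  rar :: "'r \<Rightarrow> nat"

definition countable_lang :: "('f, 'r) lang \<Rightarrow> bool" where
  "countable_lang L \<longleftrightarrow> countable (Funs L) \<and> countable (Rels L)"

record ('a, 'f, 'r) struct =
  universe :: "'a set"
  fint :: "'f \<Rightarrow> 'a list \<Rightarrow> 'a"
  rint :: "'r \<Rightarrow> 'a list \<Rightarrow> bool"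

definition is_structure :: "('f, 'r) lang \<Rightarrow> ('a, 'f, 'r) struct \<Rightarrow> bool" where
  "is_structure L M \<longleftrightarrow> universe M \<noteq> {} \<and>
     (\<forall>f\<in>Funs L. \<forall>xs. set xs \<subseteq> universe M \<and> length xs = far L f \<longrightarrow> fint M f xs \<in> universe M)"

definition substructure ::
  "('f, 'r) lang \<Rightarrow> ('a, 'f, 'r) struct \<Rightarrow> ('a, 'f, 'r) struct \<Rightarrow> bool" where
  "substructure L B C \<longleftrightarrow> is_structure L B \<and> is_structure L C \<and> universe B \<subseteq> universe C \<and>
     (\<forall>f\<in>Funs L. \<forall>xs. set xs \<subseteq> universe B \<and> length xs = far L f \<longrightarrow> fint B f xs = fint C f xs) \<and>
     (\<forall>r\<in>Rels L. \<forall>xs. set xs \<subseteq> universe B \<and> length xs = rar L r \<longrightarrow> rint B r xs = rint C r xs)"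

definition isomorphism ::
  "('f, 'r) lang \<Rightarrow> ('a, 'f, 'r) struct \<Rightarrow> ('b, 'f, 'r) struct \<Rightarrow> ('a \<Rightarrow> 'b) \<Rightarrow> bool" where
  "isomorphism L M N h \<longleftrightarrow> bij_betw h (universe M) (universe N) \<and>
     (\<forall>f\<in>Funs L. \<forall>xs. set xs \<subseteq> universe M \<and> length xs = far L f \<longrightarrow>
        h (fint M f xs) = fint N f (map h xs)) \<and>
     (\<forall>r\<in>Rels L. \<forall>xs. set xs \<subseteq> universe M \<and> length xs = rar L r \<longrightarrow>
        rint M r xs = rint N r (map h xs))"

definition isomorphic ::
  "('f, 'r) lang \<Rightarrow> ('a, 'f, 'r) struct \<Rightarrow> ('b, 'f, 'r) struct \<Rightarrow> bool" where
  "isomorphic L M N \<longleftrightarrow> (\<exists>h. isomorphism L M N h)"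

inductive_set generated ::
  "('f, 'r) lang \<Rightarrow> ('a, 'f, 'r) struct \<Rightarrow> 'a set \<Rightarrow> 'a set"
  for L M G where
  base: "x \<in> G \<Longrightarrow> x \<in> generated L M G"
| app: "f \<in> Funs L \<Longrightarrow> length xs = far L f \<Longrightarrow> \<forall>x\<in>set xs. x \<in> generated L M G \<Longrightarrow>
    fint M f xs \<in> generated L M G"

definition finitely_generated :: "('f, 'r) lang \<Rightarrow> ('a, 'f, 'r) struct \<Rightarrow> bool" where
  "finitely_generated L M \<longleftrightarrow>
     (\<exists>G. finite G \<and> G \<subseteq> universe M \<and> generated L M G = universe M)"


section \<open>Formulas of the infinitary logic\<close>

datatype 'f tm = Var nat | App 'f "'f tm list"

text \<open>\<open>BigAnd I \<Phi>\<close> and \<open>BigOr I \<Phi>\<close> are the conjunction and the disjunction of the \<open>\<Phi> i\<close>, \<open>i \<in> I\<close>;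
  since \<open>I\<close> is an arbitrary set of natural numbers, these are exactly the countable (possibly
  finite or empty) ones.\<close>

datatype ('f, 'r) fm =
    Bot
  | Eq "'f tm" "'f tm"
  | Rel 'r "'f tm list"
  | Neg "('f, 'r) fm"
  | Conj "('f, 'r) fm" "('f, 'r) fm"
  | Disj "('f, 'r) fm" "('f, 'r) fm"
  | BigAnd "nat set" "nat \<Rightarrow> ('f, 'r) fm"
  | BigOr "nat set" "nat \<Rightarrow> ('f, 'r) fm"
  | Ex nat "('f, 'r) fm"
  | All nat "('f, 'r) fm"

primrec wf_tm :: "('f, 'r) lang \<Rightarrow> 'f tm \<Rightarrow> bool" where
  "wf_tm L (Var i) \<longleftrightarrow> True"
| "wf_tm L (App f ts) \<longleftrightarrow> f \<in> Funs L \<and> length ts = far L f \<and> list_all (wf_tm L) ts"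

primrec tval :: "('a, 'f, 'r) struct \<Rightarrow> (nat \<Rightarrow> 'a) \<Rightarrow> 'f tm \<Rightarrow> 'a" where
  "tval M v (Var i) = v i"
| "tval M v (App f ts) = fint M f (map (tval M v) ts)"

primrec tvars :: "'f tm \<Rightarrow> nat set" where
  "tvars (Var i) = {i}"
| "tvars (App f ts) = \<Union> (set (map tvars ts))"

primrec fv :: "('f, 'r) fm \<Rightarrow> nat set" where
  "fv Bot = {}"
| "fv (Eq s t) = tvars s \<union> tvars t"
| "fv (Rel r ts) = \<Union> (set (map tvars ts))"
| "fv (Neg \<phi>) = fv \<phi>"
| "fv (Conj \<phi> \<psi>) = fv \<phi> \<union> fv \<psi>"
| "fv (Disj \<phi> \<psi>) = fv \<phi> \<union> fv \<psi>"
| "fv (BigAnd I \<Phi>) = (\<Union>i\<in>I. fv (\<Phi> i))"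
| "fv (BigOr I \<Phi>) = (\<Union>i\<in>I. fv (\<Phi> i))"
| "fv (Ex x \<phi>) = fv \<phi> - {x}"
| "fv (All x \<phi>) = fv \<phi> - {x}"

primrec sat :: "('a, 'f, 'r) struct \<Rightarrow> (nat \<Rightarrow> 'a) \<Rightarrow> ('f, 'r) fm \<Rightarrow> bool" where
  "sat M v Bot \<longleftrightarrow> False"
| "sat M v (Eq s t) \<longleftrightarrow> tval M v s = tval M v t"
| "sat M v (Rel r ts) \<longleftrightarrow> rint M r (map (tval M v) ts)"
| "sat M v (Neg \<phi>) \<longleftrightarrow> \<not> sat M v \<phi>"
| "sat M v (Conj \<phi> \<psi>) \<longleftrightarrow> sat M v \<phi> \<and> sat M v \<psi>"
| "sat M v (Disj \<phi> \<psi>) \<longleftrightarrow> sat M v \<phi> \<or> sat M v \<psi>"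
| "sat M v (BigAnd I \<Phi>) \<longleftrightarrow> (\<forall>i\<in>I. sat M v (\<Phi> i))"
| "sat M v (BigOr I \<Phi>) \<longleftrightarrow> (\<exists>i\<in>I. sat M v (\<Phi> i))"
| "sat M v (Ex x \<phi>) \<longleftrightarrow> (\<exists>a\<in>universe M. sat M (v(x := a)) \<phi>)"
| "sat M v (All x \<phi>) \<longleftrightarrow> (\<forall>a\<in>universe M. sat M (v(x := a)) \<phi>)"

definition Exs :: "nat list \<Rightarrow> ('f, 'r) fm \<Rightarrow> ('f, 'r) fm" where
  "Exs xs \<phi> = foldr Ex xs \<phi>"

definition Alls :: "nat list \<Rightarrow> ('f, 'r) fm \<Rightarrow> ('f, 'r) fm" where
  "Alls xs \<phi> = foldr All xs \<phi>"

inductive qfree :: "('f, 'r) lang \<Rightarrow> ('f, 'r) fm \<Rightarrow> bool" for L where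
  "qfree L Bot"
| "wf_tm L s \<Longrightarrow> wf_tm L t \<Longrightarrow> qfree L (Eq s t)"
| "r \<in> Rels L \<Longrightarrow> length ts = rar L r \<Longrightarrow> list_all (wf_tm L) ts \<Longrightarrow> qfree L (Rel r ts)"
| "qfree L \<phi> \<Longrightarrow> qfree L (Neg \<phi>)"
| "qfree L \<phi> \<Longrightarrow> qfree L \<psi> \<Longrightarrow> qfree L (Conj \<phi> \<psi>)"
| "qfree L \<phi> \<Longrightarrow> qfree L \<psi> \<Longrightarrow> qfree L (Disj \<phi> \<psi>)"

text \<open>The hierarchy at its finite levels. As usual for this logic, a formula has only finitely many
  free variables; this is the role of the finiteness conditions.\<close>

inductive is_Sigma :: "('f, 'r) lang \<Rightarrow> nat \<Rightarrow> ('f, 'r) fm \<Rightarrow> bool"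
  and is_Pi :: "('f, 'r) lang \<Rightarrow> nat \<Rightarrow> ('f, 'r) fm \<Rightarrow> bool"
  for L where
  Sigma_0: "qfree L \<phi> \<Longrightarrow> is_Sigma L 0 \<phi>"
| Pi_0: "qfree L \<phi> \<Longrightarrow> is_Pi L 0 \<phi>"
| Sigma_pos: "n > 0 \<Longrightarrow> \<forall>i\<in>I. b i < n \<and> is_Pi L (b i) (\<Phi> i) \<Longrightarrow>
    finite (fv (BigOr I (\<lambda>i. Exs (xs i) (\<Phi> i)))) \<Longrightarrow>
    is_Sigma L n (BigOr I (\<lambda>i. Exs (xs i) (\<Phi> i)))"
| Pi_pos: "n > 0 \<Longrightarrow> \<forall>i\<in>I. b i < n \<and> is_Sigma L (b i) (\<Phi> i) \<Longrightarrow>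
    finite (fv (BigAnd I (\<lambda>i. Alls (xs i) (\<Phi> i)))) \<Longrightarrow>
    is_Pi L n (BigAnd I (\<lambda>i. Alls (xs i) (\<Phi> i)))"


section \<open>Elementarity and theories\<close>

text \<open>A formula with parameters from \<open>B\<close> is a formula together with an assignment of elements of
  \<open>B\<close> to its free variables.\<close>

definition Sigma_elementary ::
  "nat \<Rightarrow> ('f, 'r) lang \<Rightarrow> ('a, 'f, 'r) struct \<Rightarrow> ('a, 'f, 'r) struct \<Rightarrow> bool" where
  "Sigma_elementary n L B C \<longleftrightarrow> substructure L B C \<and>
     (\<forall>\<phi> v. is_Sigma L n \<phi> \<and> range v \<subseteq> universe B \<and> sat C v \<phi> \<longrightarrow> sat B v \<phi>)"

definition holds :: "('a, 'f, 'r) struct \<Rightarrow> ('f, 'r) fm \<Rightarrow> bool" where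
  "holds M \<phi> \<longleftrightarrow> (\<forall>v. range v \<subseteq> universe M \<longrightarrow> sat M v \<phi>)"

definition Th :: "nat \<Rightarrow> ('f, 'r) lang \<Rightarrow> ('a, 'f, 'r) struct \<Rightarrow> ('f, 'r) fm set" where
  "Th n L M = {\<phi>. (is_Sigma L n \<phi> \<or> is_Pi L n \<phi>) \<and> fv \<phi> = {} \<and> holds M \<phi>}"

definition is_model ::
  "('f, 'r) lang \<Rightarrow> ('a, 'f, 'r) struct \<Rightarrow> ('f, 'r) fm set \<Rightarrow> bool" where
  "is_model L M T \<longleftrightarrow> is_structure L M \<and> (\<forall>\<phi>\<in>T. holds M \<phi>)"

text \<open>The models range over structures whose universe is a set of natural numbers. Over a countable
  language this is no restriction, since a finitely generated structure is then countable: see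
  \<open>quasi_categorical_any\<close> below, where the model lives in an arbitrary type.\<close>

definition quasi_categorical :: "('f, 'r) lang \<Rightarrow> ('a, 'f, 'r) struct \<Rightarrow> bool" where
  "quasi_categorical L A \<longleftrightarrow>
     (\<forall>M :: (nat, 'f, 'r) struct.
        finitely_generated L M \<and> is_model L M (Th 2 L A) \<longrightarrow> isomorphic L M A)"


section \<open>Independence of the type of the models\<close>

lemma countable_generated:
  assumes L: "countable (Funs L)" and G: "countable G"
  shows "countable (generated L M G)"
proof -
  define step where "step S = S \<union> (\<lambda>(f, xs). fint M f xs) ` (Funs L \<times> lists S)" for S
  have cnt: "countable ((step ^^ n) G)" for n
    by (induction n) (auto simp: G L step_def)
  have mono: "m \<le> n \<Longrightarrow> (step ^^ m) G \<subseteq> (step ^^ n) G" for m n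
    by (rule lift_Suc_mono_le[of "\<lambda>n. (step ^^ n) G"]) (auto simp: step_def)
  have list: "\<exists>n. set xs \<subseteq> (step ^^ n) G" if "\<forall>x\<in>set xs. \<exists>n. x \<in> (step ^^ n) G" for xs
    using that
  proof (induction xs)
    case (Cons a xs)
    then obtain m n where "a \<in> (step ^^ m) G" "set xs \<subseteq> (step ^^ n) G" by auto
    then show ?case
      using mono[of m "max m n"] mono[of n "max m n"] by (intro exI[of _ "max m n"]) auto
  qed simp
  have "\<exists>n. x \<in> (step ^^ n) G" if "x \<in> generated L M G" for x
    using that
  proof (induction rule: generated.induct)
    case (base x)
    then show ?case by (intro exI[of _ 0]) simp
  next
    case (app f xs)
    then obtain n where "set xs \<subseteq> (step ^^ n) G" using list by blast
    then have "fint M f xs \<in> (step ^^ Suc n) G" using app(1) by (auto simp: step_def)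
    then show ?case by blast
  qed
  then have "generated L M G \<subseteq> (\<Union>n. (step ^^ n) G)" by auto
  then show ?thesis by (rule countable_subset) (simp add: cnt)
qed

lemma isomorphic_sym:
  assumes M: "is_structure L M" and iso: "isomorphic L M N"
  shows "isomorphic L N M"
proof -
  obtain h where h: "isomorphism L M N h" using iso by (auto simp: isomorphic_def)
  define g where "g = inv_into (universe M) h"
  have b: "bij_betw h (universe M) (universe N)" using h by (simp add: isomorphism_def)
  have g: "bij_betw g (universe N) (universe M)" unfolding g_def by (rule bij_betw_inv_into[OF b])
  have gh: "g (h x) = x" if "x \<in> universe M" for x
    using b that by (simp add: g_def bij_betw_inv_into_left)
  have hg: "h (g y) = y" if "y \<in> universe N" for y
    using b that by (simp add: g_def bij_betw_inv_into_right)
  have sub: "set (map g xs) \<subseteq> universe M" if "set xs \<subseteq> universe N" for xs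
    using that g by (auto simp: bij_betw_def)
  have mp: "map h (map g xs) = xs" if "set xs \<subseteq> universe N" for xs
    using that hg by (auto intro!: map_idI)
  have "g (fint N f xs) = fint M f (map g xs)"
    if "f \<in> Funs L" "set xs \<subseteq> universe N" "length xs = far L f" for f xs
  proof -
    have "h (fint M f (map g xs)) = fint N f xs"
      using h that sub[OF that(2)] mp[OF that(2)] unfolding isomorphism_def
      by (metis length_map)
    moreover have "fint M f (map g xs) \<in> universe M"
      using M that sub[OF that(2)] unfolding is_structure_def by (metis length_map)
    ultimately show ?thesis using gh by metis
  qed
  moreover have "rint N r xs = rint M r (map g xs)"
    if "r \<in> Rels L" "set xs \<subseteq> universe N" "length xs = rar L r" for r xs
    using h that sub[OF that(2)] mp[OF that(2)] unfolding isomorphism_def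
    by (metis length_map)
  ultimately show ?thesis using g unfolding isomorphic_def isomorphism_def by blast
qed

lemma isomorphic_trans:
  assumes "isomorphic L M N" "isomorphic L N K"
  shows "isomorphic L M K"
proof -
  obtain h g where h: "isomorphism L M N h" and g: "isomorphism L N K g"
    using assms by (auto simp: isomorphic_def)
  have sub: "set (map h xs) \<subseteq> universe N" if "set xs \<subseteq> universe M" for xs
    using h that by (auto simp: isomorphism_def bij_betw_def)
  have "bij_betw (g \<circ> h) (universe M) (universe K)"
    using h g by (auto simp: isomorphism_def intro: bij_betw_trans)
  moreover have "(g \<circ> h) (fint M f xs) = fint K f (map (g \<circ> h) xs)"
    if "f \<in> Funs L" "set xs \<subseteq> universe M" "length xs = far L f" for f xs
    using h g that sub[OF that(2)] unfolding isomorphism_def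
    by (metis comp_apply length_map map_map)
  moreover have "rint M r xs = rint K r (map (g \<circ> h) xs)"
    if "r \<in> Rels L" "set xs \<subseteq> universe M" "length xs = rar L r" for r xs
    using h g that sub[OF that(2)] unfolding isomorphism_def
    by (metis length_map map_map)
  ultimately show ?thesis unfolding isomorphic_def isomorphism_def by blast
qed

lemma tval_in_univ:
  assumes M: "is_structure L M" and v: "range v \<subseteq> universe M"
  shows "wf_tm L t \<Longrightarrow> tval M v t \<in> universe M"
proof (induction t)
  case (App f ts)
  then have "set (map (tval M v) ts) \<subseteq> universe M" by (auto simp: list_all_iff)
  then show ?case using App(2) M by (auto simp: is_structure_def)
qed (use v in auto)

lemma tval_isomorphism:
  assumes M: "is_structure L M" and v: "range v \<subseteq> universe M" and h: "isomorphism L M N h"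
  shows "wf_tm L t \<Longrightarrow> tval N (\<lambda>i. h (v i)) t = h (tval M v t)"
proof (induction t)
  case (App f ts)
  have "set (map (tval M v) ts) \<subseteq> universe M"
    using App(2) tval_in_univ[OF M v] by (auto simp: list_all_iff)
  then have "h (fint M f (map (tval M v) ts)) = fint N f (map h (map (tval M v) ts))"
    using App(2) h unfolding isomorphism_def by (metis length_map wf_tm.simps(2))
  moreover have "map (tval N (\<lambda>i. h (v i))) ts = map h (map (tval M v) ts)"
    using App by (auto simp: list_all_iff)
  ultimately show ?case by (simp only: tval.simps)
qed simp

lemma sat_isomorphism_qfree:
  assumes M: "is_structure L M" and h: "isomorphism L M N h"
  shows "qfree L \<phi> \<Longrightarrow> range v \<subseteq> universe M \<Longrightarrow> sat N (\<lambda>i. h (v i)) \<phi> \<longleftrightarrow> sat M v \<phi>"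
proof (induction rule: qfree.induct)
  case (2 s t)
  have "inj_on h (universe M)" using h by (simp add: isomorphism_def bij_betw_def)
  then show ?case
    using 2 tval_isomorphism[OF M _ h] tval_in_univ[OF M] by (simp add: inj_on_eq_iff)
next
  case (3 r ts)
  have "set (map (tval M v) ts) \<subseteq> universe M"
    using 3 tval_in_univ[OF M] by (auto simp: list_all_iff)
  then have "rint M r (map (tval M v) ts) = rint N r (map h (map (tval M v) ts))"
    using 3 h unfolding isomorphism_def by (metis length_map)
  moreover have "map (tval N (\<lambda>i. h (v i))) ts = map h (map (tval M v) ts)"
    using 3 tval_isomorphism[OF M _ h] by (auto simp: list_all_iff)
  ultimately show ?case by (simp only: sat.simps)
qed auto

lemma sat_isomorphism_quantifiers:
  assumes h: "bij_betw h (universe M) (universe N)"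
    and \<phi>: "\<And>v. range v \<subseteq> universe M \<Longrightarrow> sat N (\<lambda>i. h (v i)) \<phi> \<longleftrightarrow> sat M v \<phi>"
  shows "range v \<subseteq> universe M \<Longrightarrow> sat N (\<lambda>i. h (v i)) (Exs xs \<phi>) \<longleftrightarrow> sat M v (Exs xs \<phi>)"
    and "range v \<subseteq> universe M \<Longrightarrow> sat N (\<lambda>i. h (v i)) (Alls xs \<phi>) \<longleftrightarrow> sat M v (Alls xs \<phi>)"
proof -
  have N: "universe N = h ` universe M" using h by (simp add: bij_betw_def)
  have upd: "(\<lambda>i. h (v i))(x := h a) = (\<lambda>i. h ((v(x := a)) i))" for v :: "nat \<Rightarrow> _" and x a
    by (auto simp: fun_eq_iff)
  have rng: "range (v(x := a)) \<subseteq> universe M" if "range v \<subseteq> universe M" "a \<in> universe M"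
    for v :: "nat \<Rightarrow> _" and x a
    using that by auto
  show "range v \<subseteq> universe M \<Longrightarrow> sat N (\<lambda>i. h (v i)) (Exs xs \<phi>) \<longleftrightarrow> sat M v (Exs xs \<phi>)"
  proof (induction xs arbitrary: v)
    case Nil
    then show ?case using \<phi> by (simp add: Exs_def)
  next
    case (Cons x xs)
    have "sat N ((\<lambda>i. h (v i))(x := h a)) (Exs xs \<phi>) \<longleftrightarrow> sat M (v(x := a)) (Exs xs \<phi>)"
      if "a \<in> universe M" for a
      unfolding upd by (rule Cons.IH[OF rng[OF Cons.prems that]])
    then show ?case by (auto simp: Exs_def N)
  qed
  show "range v \<subseteq> universe M \<Longrightarrow> sat N (\<lambda>i. h (v i)) (Alls xs \<phi>) \<longleftrightarrow> sat M v (Alls xs \<phi>)"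
  proof (induction xs arbitrary: v)
    case Nil
    then show ?case using \<phi> by (simp add: Alls_def)
  next
    case (Cons x xs)
    have "sat N ((\<lambda>i. h (v i))(x := h a)) (Alls xs \<phi>) \<longleftrightarrow> sat M (v(x := a)) (Alls xs \<phi>)"
      if "a \<in> universe M" for a
      unfolding upd by (rule Cons.IH[OF rng[OF Cons.prems that]])
    then show ?case by (auto simp: Alls_def N)
  qed
qed

lemma sat_isomorphism:
  assumes M: "is_structure L M" and h: "isomorphism L M N h"
  shows "is_Sigma L n \<phi> \<Longrightarrow> \<forall>v. range v \<subseteq> universe M \<longrightarrow> sat N (\<lambda>i. h (v i)) \<phi> = sat M v \<phi>"
    and "is_Pi L n \<phi> \<Longrightarrow> \<forall>v. range v \<subseteq> universe M \<longrightarrow> sat N (\<lambda>i. h (v i)) \<phi> = sat M v \<phi>"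
proof (induction rule: is_Sigma_is_Pi.inducts)
  case (Sigma_pos n I b \<Phi> xs)
  have b: "bij_betw h (universe M) (universe N)" using h by (simp add: isomorphism_def)
  have "sat N (\<lambda>i. h (v i)) (Exs (xs i) (\<Phi> i)) = sat M v (Exs (xs i) (\<Phi> i))"
    if "i \<in> I" "range v \<subseteq> universe M" for i v
    by (rule sat_isomorphism_quantifiers(1)[OF b _ that(2)]) (use Sigma_pos that in blast)
  then show ?case by simp
next
  case (Pi_pos n I b \<Phi> xs)
  have b: "bij_betw h (universe M) (universe N)" using h by (simp add: isomorphism_def)
  have "sat N (\<lambda>i. h (v i)) (Alls (xs i) (\<Phi> i)) = sat M v (Alls (xs i) (\<Phi> i))"
    if "i \<in> I" "range v \<subseteq> universe M" for i v
    by (rule sat_isomorphism_quantifiers(2)[OF b _ that(2)]) (use Pi_pos that in blast)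
  then show ?case by simp
qed (use sat_isomorphism_qfree[OF M h] in auto)

lemma holds_isomorphic:
  assumes M: "is_structure L M" and iso: "isomorphic L M N"
    and \<phi>: "is_Sigma L n \<phi> \<or> is_Pi L n \<phi>" and holds: "holds M \<phi>"
  shows "holds N \<phi>"
  unfolding holds_def
proof (intro allI impI)
  fix w :: "nat \<Rightarrow> _" assume w: "range w \<subseteq> universe N"
  obtain h where h: "isomorphism L M N h" using iso by (auto simp: isomorphic_def)
  have b: "bij_betw h (universe M) (universe N)" using h by (simp add: isomorphism_def)
  define v where "v = inv_into (universe M) h \<circ> w"
  have v: "range v \<subseteq> universe M"
    using w bij_betw_inv_into[OF b] by (auto simp: v_def bij_betw_def)
  have "(\<lambda>i. h (v i)) = w"
    using w bij_betw_inv_into_right[OF b] by (auto simp: v_def fun_eq_iff range_subsetD)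
  moreover have "sat N (\<lambda>i. h (v i)) \<phi> = sat M v \<phi>"
    using sat_isomorphism[OF M h] \<phi> v by blast
  ultimately show "sat N w \<phi>" using holds v by (simp add: holds_def)
qed

lemma finitely_generated_isomorphic:
  assumes M: "finitely_generated L M" and iso: "isomorphic L M N" and N: "is_structure L N"
  shows "finitely_generated L N"
proof -
  obtain h where h: "isomorphism L M N h" using iso by (auto simp: isomorphic_def)
  obtain G where G: "finite G" "G \<subseteq> universe M" "generated L M G = universe M"
    using M by (auto simp: finitely_generated_def)
  have im: "h ` universe M = universe N" using h by (simp add: isomorphism_def bij_betw_def)
  have "h x \<in> generated L N (h ` G)" if "x \<in> generated L M G" for x
    using that
  proof (induction rule: generated.induct)
    case (app f xs)
    have "set xs \<subseteq> universe M" using app(3) G(3) by auto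
    then have "h (fint M f xs) = fint N f (map h xs)"
      using h app(1,2) by (auto simp: isomorphism_def)
    moreover have "fint N f (map h xs) \<in> generated L N (h ` G)"
      using app by (intro generated.app) auto
    ultimately show ?case by simp
  qed (auto intro: generated.base)
  then have 1: "universe N \<subseteq> generated L N (h ` G)" unfolding im[symmetric] using G(3) by auto
  have "x \<in> universe N" if "x \<in> generated L N (h ` G)" for x
    using that
  proof (induction rule: generated.induct)
    case (app f xs)
    then show ?case using N unfolding is_structure_def by (meson subsetI)
  qed (use G(2) im in auto)
  then have "generated L N (h ` G) = universe N" using 1 by auto
  then show ?thesis
    using G(1) image_mono[OF G(2), of h] unfolding im finitely_generated_def
    by (intro exI[of _ "h ` G"]) auto
qed

lemma ex_nat_copy:
  fixes M :: "('a, 'f, 'r) struct"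
  assumes L: "countable_lang L" and M: "is_structure L M" "finitely_generated L M"
  shows "\<exists>N :: (nat, 'f, 'r) struct. is_structure L N \<and> isomorphic L M N"
proof -
  have "countable (universe M)"
    using L M(2) countable_generated unfolding countable_lang_def finitely_generated_def
    by (metis countable_finite)
  then obtain h :: "'a \<Rightarrow> nat" where h: "inj_on h (universe M)" by (auto simp: countable_def)
  define g where "g = inv_into (universe M) h"
  have gh: "g (h x) = x" if "x \<in> universe M" for x using h that by (simp add: g_def)
  have mgh: "map (g \<circ> h) xs = xs" if "set xs \<subseteq> universe M" for xs
    using that gh by (intro map_idI) auto
  define N :: "(nat, 'f, 'r) struct" where
    "N = \<lparr>universe = h ` universe M, fint = \<lambda>f xs. h (fint M f (map g xs)),
          rint = \<lambda>r xs. rint M r (map g xs)\<rparr>"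
  have "set (map g xs) \<subseteq> universe M" if "set xs \<subseteq> universe N" for xs
    using that gh by (auto simp: N_def)
  then have "is_structure L N" using M(1) by (simp add: is_structure_def N_def)
  moreover have "isomorphism L M N h"
    using h mgh by (auto simp: isomorphism_def bij_betw_def N_def)
  ultimately show ?thesis by (auto simp: isomorphic_def)
qed

theorem quasi_categorical_any:
  fixes A :: "('a, 'f, 'r) struct" and M :: "('b, 'f, 'r) struct"
  assumes L: "countable_lang L" and qc: "quasi_categorical L A"
    and fg: "finitely_generated L M" and M: "is_model L M (Th 2 L A)"
  shows "isomorphic L M A"
proof -
  have str: "is_structure L M" using M by (simp add: is_model_def)
  obtain N :: "(nat, 'f, 'r) struct" where N: "is_structure L N" "isomorphic L M N"
    using ex_nat_copy[OF L str fg] by blast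
  have "holds N \<phi>" if "\<phi> \<in> Th 2 L A" for \<phi>
    by (rule holds_isomorphic[OF str N(2)]) (use that M in \<open>auto simp: Th_def is_model_def\<close>)
  then have "is_model L N (Th 2 L A)" using N(1) by (simp add: is_model_def)
  then have "isomorphic L N A"
    using qc finitely_generated_isomorphic[OF fg N(2,1)] by (simp add: quasi_categorical_def)
  then show ?thesis by (rule isomorphic_trans[OF N(2)])
qed

end

theory Submission
  imports Defs
begin

text \<open>A tuple generating a finitely generated structure \<open>M\<close> realizes a countable conjunction of
  finitary universal formulas, so that a single \<open>\<Sigma>\<^sub>2\<close> sentence says that this universal type is
  realized. In any structure \<open>N\<close> satisfying it, a realization generates a
  \<open>\<Sigma>\<^sub>1\<close>-elementary copy of \<open>M\<close>. Two finitely generated structures with the same 2-theory therefore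
  embed \<open>\<Sigma>\<^sub>1\<close>-elementarily into each other. Conversely, along \<open>\<Sigma>\<^sub>1\<close>-elementary inclusions
  \<open>\<Sigma>\<^sub>2\<close> sentences go up and \<open>\<Pi>\<^sub>2\<close> sentences go down, so that a structure
  sandwiched between two copies of \<open>A\<close> is a model of the 2-theory of \<open>A\<close>.\<close>

section \<open>Free variables, assignments and quantifier blocks\<close>

lemma tval_cong: "(\<And>i. i \<in> tvars t \<Longrightarrow> v i = w i) \<Longrightarrow> tval M v t = tval M w t"
proof (induction t)
  case (App f ts)
  then have "map (tval M v) ts = map (tval M w) ts" by (auto intro!: map_cong)
  then show ?case by (simp only: tval.simps)
qed simp

lemma sat_cong: "(\<And>i. i \<in> fv \<phi> \<Longrightarrow> v i = w i) \<Longrightarrow> sat M v \<phi> \<longleftrightarrow> sat M w \<phi>"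
proof (induction \<phi> arbitrary: v w)
  case (Eq s t)
  then show ?case using tval_cong[of s v w M] tval_cong[of t v w M] by simp
next
  case (Rel r ts)
  then have "map (tval M v) ts = map (tval M w) ts" by (auto intro!: map_cong tval_cong)
  then show ?case by (simp only: sat.simps)
next
  case (Neg \<phi>)
  show ?case using Neg.IH[of v w] Neg.prems by simp
next
  case (Conj \<phi> \<psi>)
  show ?case using Conj.IH[of v w] Conj.prems by simp
next
  case (Disj \<phi> \<psi>)
  show ?case using Disj.IH[of v w] Disj.prems by simp
next
  case (BigAnd I \<Phi>)
  have "sat M v (\<Phi> i) = sat M w (\<Phi> i)" if "i \<in> I" for i
    by (rule BigAnd.IH) (use BigAnd.prems that in auto)
  then show ?case by simp
next
  case (BigOr I \<Phi>)
  have "sat M v (\<Phi> i) = sat M w (\<Phi> i)" if "i \<in> I" for i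
    by (rule BigOr.IH) (use BigOr.prems that in auto)
  then show ?case by simp
next
  case (Ex x \<phi>)
  have "sat M (v(x := a)) \<phi> = sat M (w(x := a)) \<phi>" for a
    by (rule Ex.IH) (use Ex.prems in auto)
  then show ?case by simp
next
  case (All x \<phi>)
  have "sat M (v(x := a)) \<phi> = sat M (w(x := a)) \<phi>" for a
    by (rule All.IH) (use All.prems in auto)
  then show ?case by simp
qed simp

lemma holds_sentence: "fv \<phi> = {} \<Longrightarrow> sat M v \<phi> \<Longrightarrow> holds M \<phi>"
  unfolding holds_def by (metis empty_iff sat_cong)

lemma finite_tvars: "finite (tvars t)"
  by (induction t) auto

lemma finite_fv_qfree: "qfree L \<phi> \<Longrightarrow> finite (fv \<phi>)"
  by (induction rule: qfree.induct) (auto simp: finite_tvars)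

lemma fv_Exs [simp]: "fv (Exs xs \<phi>) = fv \<phi> - set xs"
  by (induction xs) (auto simp: Exs_def)

lemma fv_Alls [simp]: "fv (Alls xs \<phi>) = fv \<phi> - set xs"
  by (induction xs) (auto simp: Alls_def)

lemma sat_Exs:
  "sat M v (Exs xs \<phi>) \<longleftrightarrow>
     (\<exists>u. (\<forall>i. i \<notin> set xs \<longrightarrow> u i = v i) \<and> u ` set xs \<subseteq> universe M \<and> sat M u \<phi>)"
proof (induction xs arbitrary: v)
  case Nil
  have "(\<forall>i. u i = v i) \<longleftrightarrow> u = v" for u by auto
  then show ?case by (simp add: Exs_def)
next
  case (Cons x xs)
  have "sat M v (Exs (x # xs) \<phi>) \<longleftrightarrow> (\<exists>a\<in>universe M. sat M (v(x := a)) (Exs xs \<phi>))"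
    by (simp add: Exs_def)
  also have "\<dots> \<longleftrightarrow> (\<exists>a\<in>universe M. \<exists>u. (\<forall>i. i \<notin> set xs \<longrightarrow> u i = (v(x := a)) i) \<and>
      u ` set xs \<subseteq> universe M \<and> sat M u \<phi>)"
    by (simp only: Cons.IH)
  also have "\<dots> \<longleftrightarrow> (\<exists>u. (\<forall>i. i \<notin> set (x # xs) \<longrightarrow> u i = v i) \<and>
      u ` set (x # xs) \<subseteq> universe M \<and> sat M u \<phi>)" (is "?l \<longleftrightarrow> ?r")
  proof
    assume ?l
    then obtain a u where "a \<in> universe M" "\<forall>i. i \<notin> set xs \<longrightarrow> u i = (v(x := a)) i"
      "u ` set xs \<subseteq> universe M" "sat M u \<phi>" by blast
    \<comment> \<open>If \<open>x\<close> is bound again inside \<open>xs\<close>, the inner value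
      overrides \<open>a\<close>, and \<open>u x\<close> lies in the universe anyway; otherwise
      \<open>u x = a\<close>.\<close>
    then show ?r by (intro exI[of _ u]) (cases "x \<in> set xs"; auto)
  next
    assume ?r
    then obtain u where "\<forall>i. i \<notin> set (x # xs) \<longrightarrow> u i = v i"
      "u ` set (x # xs) \<subseteq> universe M" "sat M u \<phi>" by blast
    then show ?l by (intro bexI[of _ "u x"] exI[of _ u]) auto
  qed
  finally show ?case .
qed

section \<open>Dual formulas\<close>

text \<open>Negation is pushed only through infinitary connectives and quantifiers. In the hierarchy
  the finitary constructors occur only inside quantifier-free matrices, a class already closed under
  \<open>Neg\<close>.\<close>

primrec dual :: "('f, 'r) fm \<Rightarrow> ('f, 'r) fm" where
  "dual Bot = Neg Bot"
| "dual (Eq s t) = Neg (Eq s t)"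
| "dual (Rel r ts) = Neg (Rel r ts)"
| "dual (Neg \<phi>) = Neg (Neg \<phi>)"
| "dual (Conj \<phi> \<psi>) = Neg (Conj \<phi> \<psi>)"
| "dual (Disj \<phi> \<psi>) = Neg (Disj \<phi> \<psi>)"
| "dual (BigAnd I \<Phi>) = BigOr I (\<lambda>i. dual (\<Phi> i))"
| "dual (BigOr I \<Phi>) = BigAnd I (\<lambda>i. dual (\<Phi> i))"
| "dual (Ex x \<phi>) = All x (dual \<phi>)"
| "dual (All x \<phi>) = Ex x (dual \<phi>)"

lemma sat_dual [simp]: "sat M v (dual \<phi>) \<longleftrightarrow> \<not> sat M v \<phi>"
  by (induction \<phi> arbitrary: v) auto

lemma fv_dual [simp]: "fv (dual \<phi>) = fv \<phi>"
  by (induction \<phi>) auto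

lemma dual_Exs [simp]: "dual (Exs xs \<phi>) = Alls xs (dual \<phi>)"
  by (induction xs) (auto simp: Exs_def Alls_def)

lemma dual_Alls [simp]: "dual (Alls xs \<phi>) = Exs xs (dual \<phi>)"
  by (induction xs) (auto simp: Exs_def Alls_def)

lemma sat_Alls:
  "sat M v (Alls xs \<phi>) \<longleftrightarrow>
     (\<forall>u. (\<forall>i. i \<notin> set xs \<longrightarrow> u i = v i) \<and> u ` set xs \<subseteq> universe M \<longrightarrow> sat M u \<phi>)"
proof -
  have "\<not> sat M v (Alls xs \<phi>) \<longleftrightarrow> sat M v (Exs xs (dual \<phi>))"
    by (simp flip: dual_Alls)
  then show ?thesis unfolding sat_Exs sat_dual by blast
qed

lemma qfree_dual: "qfree L \<phi> \<Longrightarrow> qfree L (dual \<phi>)"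
  by (induction rule: qfree.induct) (auto intro: qfree.intros)

lemma is_Pi_dual: "is_Sigma L n \<phi> \<Longrightarrow> is_Pi L n (dual \<phi>)"
  and is_Sigma_dual: "is_Pi L n \<phi> \<Longrightarrow> is_Sigma L n (dual \<phi>)"
proof (induction rule: is_Sigma_is_Pi.inducts)
  case (Sigma_pos n I b \<Phi> xs)
  then show ?case
    using is_Sigma_is_Pi.Pi_pos[of n I b L "\<lambda>i. dual (\<Phi> i)" xs] by auto
next
  case (Pi_pos n I b \<Phi> xs)
  then show ?case
    using is_Sigma_is_Pi.Sigma_pos[of n I b L "\<lambda>i. dual (\<Phi> i)" xs] by auto
qed (auto intro: is_Sigma_is_Pi.intros qfree_dual)

lemma is_Sigma_0: "is_Sigma L 0 \<phi> \<longleftrightarrow> qfree L \<phi>" and is_Pi_0: "is_Pi L 0 \<phi> \<longleftrightarrow> qfree L \<phi>"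
  by (auto elim: is_Sigma.cases is_Pi.cases intro: is_Sigma_is_Pi.intros)

lemma is_Sigma_1E:
  assumes "is_Sigma L 1 \<phi>"
  obtains I xs \<Phi> where "\<phi> = BigOr I (\<lambda>i. Exs (xs i) (\<Phi> i))" "\<And>i. i \<in> I \<Longrightarrow> qfree L (\<Phi> i)"
  using assms
proof (cases rule: is_Sigma.cases)
  case (Sigma_pos I b \<Phi> xs)
  then have "qfree L (\<Phi> i)" if "i \<in> I" for i
    using that by (metis is_Pi_0 less_one)
  then show ?thesis using that Sigma_pos(1) by blast
qed simp

section \<open>Countability of the quantifier-free formulas\<close>

text \<open>Terms and quantifier-free formulas are elements of absolutely free algebras, so that
  \<open>countable_generated\<close> applies to them.\<close>

lemma countable_wf_tm:
  fixes L :: "('f, 'r) lang"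
  assumes "countable (Funs L)"
  shows "countable {t. wf_tm L t}"
proof -
  define T :: "('f tm, 'f, 'r) struct" where
    "T = \<lparr>universe = UNIV, fint = App, rint = \<lambda>_ _. True\<rparr>"
  have "wf_tm L t \<Longrightarrow> t \<in> generated L T (range Var)" for t
  proof (induction t)
    case (App f ts)
    have "fint T f ts \<in> generated L T (range Var)"
      by (rule generated.app) (use App in \<open>auto simp: list_all_iff\<close>)
    then show ?case by (simp add: T_def)
  qed (auto intro: generated.base)
  then have "{t. wf_tm L t} \<subseteq> generated L T (range Var)" by blast
  then show ?thesis by (rule countable_subset) (auto intro: countable_generated assms)
qed

lemma countable_qfree:
  fixes L :: "('f, 'r) lang"
  assumes L: "countable_lang L"
  shows "countable {\<phi>. qfree L \<phi>}"
proof -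
  \<comment> \<open>The symbols 0, 1, 2 stand for negation, conjunction and disjunction. The
    formulas form an algebra for them, generated by the set \<open>G\<close> of \<open>Bot\<close>
    and the atomic formulas.\<close>
  define C :: "(nat, unit) lang" where
    "C = \<lparr>Funs = {0, 1, 2}, Rels = {}, far = \<lambda>f. if f = 0 then 1 else 2, rar = \<lambda>_. 0\<rparr>"
  define F :: "(('f, 'r) fm, nat, unit) struct" where
    "F = \<lparr>universe = UNIV,
          fint = \<lambda>f xs. if f = 0 then Neg (hd xs) else
                   if f = 1 then Conj (hd xs) (xs ! 1) else Disj (hd xs) (xs ! 1),
          rint = \<lambda>_ _. True\<rparr>"
  define G where "G = {Bot} \<union> (\<lambda>(s, t). Eq s t) ` ({t. wf_tm L t} \<times> {t. wf_tm L t}) \<union>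
    (\<lambda>(r, ts). Rel r ts) ` (Rels L \<times> lists {t. wf_tm L t})"
  have "countable G"
    using L unfolding G_def countable_lang_def by (auto simp: countable_wf_tm)
  have "qfree L \<phi> \<Longrightarrow> \<phi> \<in> generated C F G" for \<phi>
  proof (induction rule: qfree.induct)
    case (4 \<phi>)
    have "fint F 0 [\<phi>] \<in> generated C F G" by (rule generated.app) (use 4 in \<open>auto simp: C_def\<close>)
    then show ?case by (simp add: F_def)
  next
    case (5 \<phi> \<psi>)
    have "fint F 1 [\<phi>, \<psi>] \<in> generated C F G"
      by (rule generated.app) (use 5 in \<open>auto simp: C_def\<close>)
    then show ?case by (simp add: F_def)
  next
    case (6 \<phi> \<psi>)
    have "fint F 2 [\<phi>, \<psi>] \<in> generated C F G"
      by (rule generated.app) (use 6 in \<open>auto simp: C_def\<close>)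
    then show ?case by (simp add: F_def)
  qed (force intro: generated.base simp: G_def list_all_iff)+
  then have "{\<phi>. qfree L \<phi>} \<subseteq> generated C F G" by blast
  then show ?thesis
    by (rule countable_subset) (rule countable_generated, simp add: C_def, fact)
qed

section \<open>Substitution\<close>

primrec tsubst :: "(nat \<Rightarrow> 'f tm) \<Rightarrow> 'f tm \<Rightarrow> 'f tm" where
  "tsubst \<sigma> (Var i) = \<sigma> i"
| "tsubst \<sigma> (App f ts) = App f (map (tsubst \<sigma>) ts)"

text \<open>Left unspecified beyond the finitary connectives: substitution is applied to
  quantifier-free formulas alone, where no variable can be captured.\<close>

primrec (nonexhaustive) qsubst :: "(nat \<Rightarrow> 'f tm) \<Rightarrow> ('f, 'r) fm \<Rightarrow> ('f, 'r) fm" where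
  "qsubst \<sigma> Bot = Bot"
| "qsubst \<sigma> (Eq s t) = Eq (tsubst \<sigma> s) (tsubst \<sigma> t)"
| "qsubst \<sigma> (Rel r ts) = Rel r (map (tsubst \<sigma>) ts)"
| "qsubst \<sigma> (Neg \<phi>) = Neg (qsubst \<sigma> \<phi>)"
| "qsubst \<sigma> (Conj \<phi> \<psi>) = Conj (qsubst \<sigma> \<phi>) (qsubst \<sigma> \<psi>)"
| "qsubst \<sigma> (Disj \<phi> \<psi>) = Disj (qsubst \<sigma> \<phi>) (qsubst \<sigma> \<psi>)"

lemma tval_tsubst: "tval M v (tsubst \<sigma> t) = tval M (\<lambda>i. tval M v (\<sigma> i)) t"
proof (induction t)
  case (App f ts)
  then have "map (tval M v) (map (tsubst \<sigma>) ts) = map (tval M (\<lambda>i. tval M v (\<sigma> i))) ts" by simp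
  then show ?case by (simp only: tval.simps tsubst.simps)
qed simp

lemma wf_tsubst: "wf_tm L t \<Longrightarrow> (\<And>i. wf_tm L (\<sigma> i)) \<Longrightarrow> wf_tm L (tsubst \<sigma> t)"
  by (induction t) (auto simp: list_all_iff)

lemma sat_qsubst: "qfree L \<phi> \<Longrightarrow> sat M v (qsubst \<sigma> \<phi>) \<longleftrightarrow> sat M (\<lambda>i. tval M v (\<sigma> i)) \<phi>"
proof (induction rule: qfree.induct)
  case (3 r ts)
  have "map (tval M v) (map (tsubst \<sigma>) ts) = map (tval M (\<lambda>i. tval M v (\<sigma> i))) ts"
    by (simp add: tval_tsubst)
  then show ?case by (simp only: sat.simps qsubst.simps)
qed (auto simp: tval_tsubst)

lemma qfree_qsubst: "qfree L \<phi> \<Longrightarrow> (\<And>i. wf_tm L (\<sigma> i)) \<Longrightarrow> qfree L (qsubst \<sigma> \<phi>)"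
  by (induction rule: qfree.induct) (auto intro!: qfree.intros wf_tsubst simp: list_all_iff)

section \<open>Universal types of generating tuples\<close>

text \<open>An element reached by closing under the functions is the value of the term recording how
  it was reached. A finitely generated structure can thus be handled through terms in the variables
  that name its generators.\<close>

lemma generated_eq_tval:
  "generated L M (v ` X) = tval M v ` {t. wf_tm L t \<and> tvars t \<subseteq> X}" (is "_ = tval M v ` ?T")
proof
  show "generated L M (v ` X) \<subseteq> tval M v ` ?T"
  proof
    fix x assume "x \<in> generated L M (v ` X)"
    then show "x \<in> tval M v ` ?T"
    proof (induction rule: generated.induct)
      case (base x)
      then obtain i where "i \<in> X" "x = tval M v (Var i)" by auto
      then show ?case by (intro image_eqI[of _ _ "Var i"]) auto
    next
      case (app f xs)
      then have "xs \<in> lists (tval M v ` ?T)" by auto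
      then obtain ts where ts: "ts \<in> lists ?T" "xs = map (tval M v) ts"
        unfolding lists_image by auto
      then have "App f ts \<in> ?T" using app by (auto simp: list_all_iff)
      then show ?case by (rule image_eqI[rotated]) (simp add: ts)
    qed
  qed
  have "wf_tm L t \<Longrightarrow> tvars t \<subseteq> X \<Longrightarrow> tval M v t \<in> generated L M (v ` X)" for t
  proof (induction t)
    case (App f ts)
    then show ?case by (auto simp: list_all_iff intro!: generated.app) blast
  qed (auto intro: generated.base)
  then show "tval M v ` ?T \<subseteq> generated L M (v ` X)" by blast
qed

text \<open>Variables below \<open>n\<close> name a tuple, all others are implicitly universally
  quantified: the finitary universal type of the tuple \<open>v\<close> in \<open>M\<close> is
  contained in that of the tuple \<open>w\<close> in \<open>N\<close>.\<close>

definition preserves_universal ::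
  "('f, 'r) lang \<Rightarrow> nat \<Rightarrow> ('a, 'f, 'r) struct \<Rightarrow> (nat \<Rightarrow> 'a) \<Rightarrow>
    ('b, 'f, 'r) struct \<Rightarrow> (nat \<Rightarrow> 'b) \<Rightarrow> bool" where
  "preserves_universal L n M v N w \<longleftrightarrow>
     (\<forall>\<psi>. qfree L \<psi> \<and> (\<forall>u. range u \<subseteq> universe M \<and> (\<forall>i<n. u i = v i) \<longrightarrow> sat M u \<psi>) \<longrightarrow>
        (\<forall>u. range u \<subseteq> universe N \<and> (\<forall>i<n. u i = w i) \<longrightarrow> sat N u \<psi>))"

lemma ex_preserves_universal:
  fixes M :: "('a, 'f, 'r) struct" and N :: "('b, 'f, 'r) struct"
  assumes L: "countable_lang L" and v: "range v \<subseteq> universe M" and N: "universe N \<noteq> {}"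
    and Sigma: "\<And>\<phi>. is_Sigma L 2 \<phi> \<Longrightarrow> fv \<phi> = {} \<Longrightarrow> holds M \<phi> \<Longrightarrow> holds N \<phi>"
  shows "\<exists>w. range w \<subseteq> universe N \<and> preserves_universal L n M v N w"
proof -
  \<comment> \<open>These are the variables to be bound by universal quantifiers, so that only the
    variables of the tuple stay free.\<close>
  define others where "others \<psi> = sorted_list_of_set (fv \<psi> - {..<n})" for \<psi> :: "('f, 'r) fm"
  have set_others: "set (others \<psi>) = fv \<psi> - {..<n}" if "qfree L \<psi>" for \<psi>
    using finite_fv_qfree[OF that] by (simp add: others_def)
  define \<Gamma> where "\<Gamma> = {\<psi>. qfree L \<psi> \<and> sat M v (Alls (others \<psi>) \<psi>)}"
  \<comment> \<open>A trivially true member makes \<open>\<Gamma>\<close> nonempty, so that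
    \<open>from_nat_into\<close> enumerates exactly \<open>\<Gamma>\<close>.\<close>
  have "Neg Bot \<in> \<Gamma>" by (auto simp: \<Gamma>_def sat_Alls intro: qfree.intros)
  moreover have "countable \<Gamma>"
    by (rule countable_subset[OF _ countable_qfree[OF L]]) (auto simp: \<Gamma>_def)
  ultimately have \<Gamma>: "range (from_nat_into \<Gamma>) = \<Gamma>"
    by (intro range_from_nat_into) auto
  have \<Gamma>_mem: "from_nat_into \<Gamma> i \<in> \<Gamma>" for i using \<Gamma> by blast
  define \<pi> where "\<pi> = BigAnd UNIV (\<lambda>i. Alls (others (from_nat_into \<Gamma> i)) (from_nat_into \<Gamma> i))"
  have sat_\<pi>: "sat K u \<pi> \<longleftrightarrow> (\<forall>\<psi>\<in>\<Gamma>. sat K u (Alls (others \<psi>) \<psi>))"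
    for K :: "('c, 'f, 'r) struct" and u
    by (subst \<Gamma>[symmetric]) (simp add: \<pi>_def)
  have fv_\<pi>: "fv \<pi> \<subseteq> {..<n}" using \<Gamma>_mem set_others by (auto simp: \<pi>_def \<Gamma>_def)
  have "is_Pi L 1 \<pi>" unfolding \<pi>_def
  proof (rule is_Sigma_is_Pi.Pi_pos[where b = "\<lambda>_. 0"])
    show "finite (fv (BigAnd UNIV (\<lambda>i. Alls (others (from_nat_into \<Gamma> i)) (from_nat_into \<Gamma> i))))"
      using fv_\<pi> unfolding \<pi>_def by (rule finite_subset) simp
  qed (use \<Gamma>_mem in \<open>auto simp: \<Gamma>_def is_Sigma_0\<close>)
  \<comment> \<open>The type is existentially closed over the tuple; the one-member disjunction only
    supplies the syntactic shape of a \<open>\<Sigma>\<^sub>2\<close> sentence. In \<open>M\<close>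
    the tuple \<open>v\<close> itself is the witness.\<close>
  define \<phi> where "\<phi> = BigOr {0} (\<lambda>i. Exs [0..<n] \<pi>)"
  have fv_\<phi>: "fv \<phi> = {}" using fv_\<pi> by (auto simp: \<phi>_def)
  moreover have "is_Sigma L 2 \<phi>"
    unfolding \<phi>_def
    by (rule is_Sigma_is_Pi.Sigma_pos[where b = "\<lambda>_. 1"])
      (use \<open>is_Pi L 1 \<pi>\<close> fv_\<phi>[unfolded \<phi>_def] in \<open>simp_all only:, auto\<close>)
  moreover have "sat M v \<phi>"
    using v by (auto simp: \<phi>_def sat_Exs sat_\<pi> \<Gamma>_def intro!: exI[of _ v])
  then have "holds M \<phi>" using fv_\<phi> by (rule holds_sentence[rotated])
  ultimately have "holds N \<phi>" by (intro Sigma)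
  \<comment> \<open>Starting from a constant assignment, the witness \<open>w\<close> equals
    \<open>b\<close> off the quantified block, so all its values lie in \<open>N\<close>.\<close>
  obtain b where b: "b \<in> universe N" using N by blast
  then have "sat N (\<lambda>_. b) \<phi>" using \<open>holds N \<phi>\<close> by (auto simp: holds_def)
  then obtain w where w: "\<forall>i. \<not> i < n \<longrightarrow> w i = b" "w ` {0..<n} \<subseteq> universe N" "sat N w \<pi>"
    by (auto simp: \<phi>_def sat_Exs)
  have "w i \<in> universe N" for i using w(1,2) b by (cases "i < n") auto
  then have rw: "range w \<subseteq> universe N" by auto
  have "sat N u \<psi>"
    if \<psi>: "qfree L \<psi>" and M: "\<And>u. range u \<subseteq> universe M \<Longrightarrow> (\<forall>i<n. u i = v i) \<Longrightarrow> sat M u \<psi>"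
      and u: "range u \<subseteq> universe N" "\<forall>i<n. u i = w i" for \<psi> u
  proof -
    \<comment> \<open>Such a \<open>u\<close> differs from \<open>v\<close> only at variables that
      are at least \<open>n\<close>, so it agrees with \<open>v\<close> on the tuple and the
      hypothesis on \<open>\<psi>\<close> applies.\<close>
    have "sat M u \<psi>"
      if "\<And>i. i \<notin> set (others \<psi>) \<Longrightarrow> u i = v i" "u ` set (others \<psi>) \<subseteq> universe M" for u
    proof (rule M)
      show "range u \<subseteq> universe M"
      proof
        fix x assume "x \<in> range u"
        then obtain i where "x = u i" by blast
        then show "x \<in> universe M" using that v by (cases "i \<in> set (others \<psi>)") auto
      qed
    qed (use that(1) set_others[OF \<psi>] in auto)
    then have "\<psi> \<in> \<Gamma>" using \<psi> by (auto simp: \<Gamma>_def sat_Alls)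
    then have "sat N w (Alls (others \<psi>) \<psi>)" using w(3) sat_\<pi> by blast
    \<comment> \<open>The universal block is instantiated by \<open>u\<close> and the rest is read
      from \<open>w\<close>; on the free variables of \<open>\<psi>\<close> this is
      \<open>u\<close>, which agrees with \<open>w\<close> below \<open>n\<close>.\<close>
    then have "sat N (\<lambda>i. if i \<in> set (others \<psi>) then u i else w i) \<psi>"
      using u(1) by (subst (asm) sat_Alls) (erule allE, erule mp, auto)
    then show ?thesis
      by (rule iffD1[OF sat_cong, rotated]) (use u(2) set_others[OF \<psi>] in auto)
  qed
  then have "preserves_universal L n M v N w" by (simp add: preserves_universal_def)
  then show ?thesis using rw by blast
qed

text \<open>A formula in the variables below \<open>n\<close> is equivalent to its universal closure
  over the others, so the inclusion of types carries it from \<open>v\<close> to \<open>w\<close>.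
  Applied to its negation, the same inclusion gives the converse.\<close>

lemma preserves_universal_sat_iff:
  assumes P: "preserves_universal L n M v N w" and \<psi>: "qfree L \<psi>" "fv \<psi> \<subseteq> {..<n}"
    and v: "range v \<subseteq> universe M" and w: "range w \<subseteq> universe N"
  shows "sat M v \<psi> \<longleftrightarrow> sat N w \<psi>"
proof -
  have "sat N w \<chi>" if \<chi>: "qfree L \<chi>" "fv \<chi> \<subseteq> {..<n}" and M: "sat M v \<chi>" for \<chi>
  proof -
    have "sat M u \<chi>" if "\<forall>i<n. u i = v i" for u
      using M by (rule iffD1[OF sat_cong, rotated]) (use that \<chi>(2) in auto)
    then show ?thesis using P \<chi>(1) w unfolding preserves_universal_def by blast
  qed
  from this[of \<psi>] this[of "Neg \<psi>"] show ?thesis using \<psi> by (auto intro: qfree.intros)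
qed

text \<open>The copy consists of the values at \<open>w\<close> of the terms in the first
  \<open>n\<close> variables. Atomic formulas in these variables agree at \<open>v\<close> and
  \<open>w\<close>, so evaluating at \<open>w\<close> instead of \<open>v\<close> is an isomorphism.
  A \<open>\<Sigma>\<^sub>1\<close> formula true in \<open>N\<close> with parameters in the copy
  refutes a universal formula about \<open>w\<close>, hence the same one about \<open>v\<close>; the
  counterexample in \<open>M\<close> is then moved into the copy.\<close>

lemma Sigma_elementary_copy:
  fixes M :: "('a, 'f, 'r) struct" and N :: "('b, 'f, 'r) struct"
  assumes M: "is_structure L M" and N: "is_structure L N"
    and v: "range v \<subseteq> universe M" "generated L M (v ` {..<n}) = universe M"
    and w: "range w \<subseteq> universe N" and P: "preserves_universal L n M v N w"
  shows "\<exists>D. Sigma_elementary 1 L D N \<and> isomorphic L D M"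
proof -
  define T where "T = {t. wf_tm L t \<and> tvars t \<subseteq> {..<n}}"
  have univ_M: "universe M = tval M v ` T"
    using v(2) by (simp add: generated_eq_tval T_def)
  \<comment> \<open>Only the universe of \<open>N\<close> is cut down, so \<open>D\<close> is a
    substructure once it is nonempty and closed under the functions.\<close>
  define D where "D = N\<lparr>universe := tval N w ` T\<rparr>"
  have [simp]: "universe D = tval N w ` T" "fint D = fint N" "rint D = rint N"
    by (simp_all add: D_def)
  have ex_terms: "\<exists>ts. set ts \<subseteq> T \<and> xs = map (tval K u) ts" if "set xs \<subseteq> tval K u ` T"
    for xs and K :: "('c, 'f, 'r) struct" and u
  proof -
    have "xs \<in> lists (tval K u ` T)" using that by auto
    then show ?thesis unfolding lists_image by auto
  qed
  have App_T: "App f ts \<in> T" if "f \<in> Funs L" "set ts \<subseteq> T" "length ts = far L f" for f ts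
    using that by (auto simp: T_def list_all_iff)
  \<comment> \<open>Any term denoting \<open>x\<close> may be chosen: by \<open>eq_iff\<close> its
    value at \<open>w\<close> does not depend on the choice.\<close>
  define h where "h x = tval N w (SOME t. t \<in> T \<and> tval M v t = x)" for x
  have eq_iff: "tval M v s = tval M v t \<longleftrightarrow> tval N w s = tval N w t" if "s \<in> T" "t \<in> T" for s t
    using preserves_universal_sat_iff[OF P _ _ v(1) w, of "Eq s t"] that
    by (auto simp: T_def intro: qfree.intros)
  have h: "h (tval M v t) = tval N w t" if "t \<in> T" for t
  proof -
    let ?s = "SOME s. s \<in> T \<and> tval M v s = tval M v t"
    have "?s \<in> T \<and> tval M v ?s = tval M v t"
      by (rule someI[of "\<lambda>s. s \<in> T \<and> tval M v s = tval M v t" t]) (simp add: that)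
    then have "tval N w ?s = tval N w t" using eq_iff that by blast
    then show ?thesis by (simp only: h_def)
  qed
  have map_h: "map h (map (tval M v) ts) = map (tval N w) ts" if "set ts \<subseteq> T" for ts
    using that h by auto
  have iso: "isomorphism L M D h"
    unfolding isomorphism_def
  proof (intro conjI ballI allI impI)
    show "bij_betw h (universe M) (universe D)"
      by (auto simp: bij_betw_def inj_on_def univ_M h eq_iff image_image cong: image_cong)
  next
    fix f xs assume f: "f \<in> Funs L" and "set xs \<subseteq> universe M \<and> length xs = far L f"
    then obtain ts where ts: "set ts \<subseteq> T" "xs = map (tval M v) ts" "length ts = far L f"
      using ex_terms[of xs M v] univ_M by auto
    have "h (tval M v (App f ts)) = tval N w (App f ts)" by (rule h[OF App_T[OF f ts(1,3)]])
    then show "h (fint M f xs) = fint D f (map h xs)" using map_h[OF ts(1)] by (simp add: ts(2) del: map_map)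
  next
    fix r xs assume r: "r \<in> Rels L" and "set xs \<subseteq> universe M \<and> length xs = rar L r"
    then obtain ts where ts: "set ts \<subseteq> T" "xs = map (tval M v) ts" "length ts = rar L r"
      using ex_terms[of xs M v] univ_M by auto
    have "sat M v (Rel r ts) = sat N w (Rel r ts)"
      by (rule preserves_universal_sat_iff[OF P _ _ v(1) w])
        (use r ts in \<open>auto simp: T_def list_all_iff intro!: qfree.intros\<close>)
    then show "rint M r xs = rint D r (map h xs)" using map_h[OF ts(1)] by (simp add: ts(2) del: map_map)
  qed
  have "universe D \<subseteq> universe N"
    using tval_in_univ[OF N w] by (auto simp: T_def)
  moreover have D: "is_structure L D"
    unfolding is_structure_def
  proof (intro conjI ballI allI impI)
    show "universe D \<noteq> {}" using M univ_M by (auto simp: is_structure_def)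
  next
    fix f xs assume f: "f \<in> Funs L" and "set xs \<subseteq> universe D \<and> length xs = far L f"
    then obtain ts where ts: "set ts \<subseteq> T" "xs = map (tval N w) ts" "length ts = far L f"
      using ex_terms[of xs N w] by auto
    then have "fint D f xs = tval N w (App f ts)" by simp
    then have "fint D f xs \<in> tval N w ` T" using App_T[OF f ts(1,3)] by (rule image_eqI)
    then show "fint D f xs \<in> universe D" by simp
  qed
  ultimately have sub: "substructure L D N" using N by (simp add: substructure_def)
  have "sat D u \<phi>" if \<phi>: "is_Sigma L 1 \<phi>" and u: "range u \<subseteq> universe D" "sat N u \<phi>" for \<phi> u
    using \<phi>
  proof (rule is_Sigma_1E)
    fix I xs \<Phi>
    assume \<phi>_eq: "\<phi> = BigOr I (\<lambda>i. Exs (xs i) (\<Phi> i))" and qf: "\<And>i. i \<in> I \<Longrightarrow> qfree L (\<Phi> i)"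
    obtain i y where i: "i \<in> I" and y: "\<And>j. j \<notin> set (xs i) \<Longrightarrow> y j = u j"
      "y ` set (xs i) \<subseteq> universe N" "sat N y (\<Phi> i)"
      using u(2) unfolding \<phi>_eq by (auto simp: sat_Exs)
    have "\<forall>j. \<exists>t. t \<in> T \<and> u j = tval N w t" using u(1) by auto
    then obtain t where t: "\<And>j. t j \<in> T" "\<And>j. u j = tval N w (t j)" by metis
    \<comment> \<open>The parameters of the formula are replaced by terms in the generators, and its bound
      variables are renamed apart from these.\<close>
    define \<sigma> where "\<sigma> j = (if j \<in> set (xs i) then Var (n + j) else t j)" for j
    define \<psi> where "\<psi> = Neg (qsubst \<sigma> (\<Phi> i))"
    have wf_\<sigma>: "wf_tm L (\<sigma> j)" for j using t(1) by (auto simp: \<sigma>_def T_def)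
    have \<psi>: "qfree L \<psi>" unfolding \<psi>_def by (intro qfree.intros qfree_qsubst qf i wf_\<sigma>)
    have tval_t: "tval K a (t j) = tval K b (t j)" if "\<forall>i<n. a i = b i"
      for j a b and K :: "('c, 'f, 'r) struct"
      by (rule tval_cong) (use t(1)[of j] that in \<open>auto simp: T_def\<close>)
    \<comment> \<open>Below \<open>n\<close> the tuple \<open>w\<close> is kept; variable
      \<open>n + j\<close> carries the witness \<open>y j\<close>, which undoes the renaming in
      \<open>\<sigma>\<close>.\<close>
    define w' where "w' k = (if k < n then w k else y (k - n))" for k
    have "(\<lambda>j. tval N w' (\<sigma> j)) = y"
      using tval_t[of w' w N] y(1) t(2) by (auto simp: fun_eq_iff \<sigma>_def w'_def)
    then have nw': "\<not> sat N w' \<psi>" using y(3) by (simp add: \<psi>_def sat_qsubst[OF qf[OF i]])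
    have "u j \<in> universe N" for j
      using u(1) \<open>universe D \<subseteq> universe N\<close> by blast
    then have "y j \<in> universe N" for j using y(1)[of j] y(2) by (cases "j \<in> set (xs i)") auto
    then have "range w' \<subseteq> universe N" using w by (auto simp: w'_def)
    moreover have "\<forall>i<n. w' i = w i" by (simp add: w'_def)
    \<comment> \<open>The negated matrix fails in \<open>N\<close> at an extension of the tuple
      \<open>w\<close>, so it cannot hold in \<open>M\<close> at every extension of the tuple
      \<open>v\<close>.\<close>
    ultimately obtain v' where v': "range v' \<subseteq> universe M" "\<forall>i<n. v' i = v i" "\<not> sat M v' \<psi>"
      using P \<psi> nw' unfolding preserves_universal_def by blast
    define z where "z = (\<lambda>j. tval M v' (\<sigma> j))"
    have "sat M z (\<Phi> i)"
      using v'(3) by (simp add: \<psi>_def sat_qsubst[OF qf[OF i]] z_def)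
    moreover have z: "range z \<subseteq> universe M"
      using tval_in_univ[OF M v'(1) wf_\<sigma>] by (auto simp: z_def)
    ultimately have "sat D (\<lambda>j. h (z j)) (\<Phi> i)"
      using sat_isomorphism_qfree[OF M iso qf[OF i] z] by simp
    \<comment> \<open>Off the quantified variables \<open>\<sigma> j\<close> is a term in the
      generators: its value at \<open>v'\<close> is that at \<open>v\<close>, which \<open>h\<close>
      sends to the parameter \<open>u j\<close>.\<close>
    moreover have "h (z j) = u j" if "j \<notin> set (xs i)" for j
      using that tval_t[OF v'(2)] h t by (simp add: z_def \<sigma>_def)
    moreover have "h (z j) \<in> universe D" for j
      using z iso bij_betwE[of h "universe M" "universe D"] unfolding isomorphism_def by blast
    ultimately have "sat D u (Exs (xs i) (\<Phi> i))"
      unfolding sat_Exs by (intro exI[of _ "\<lambda>j. h (z j)"]) auto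
    then show "sat D u \<phi>" using i by (auto simp: \<phi>_eq)
  qed
  then have "Sigma_elementary 1 L D N" using sub by (auto simp: Sigma_elementary_def)
  moreover have "isomorphic L D M"
    using iso isomorphic_sym[OF M] by (auto simp: isomorphic_def)
  ultimately show ?thesis by blast
qed

lemma ex_Sigma_elementary_copy:
  fixes M :: "('a, 'f, 'r) struct" and N :: "('b, 'f, 'r) struct"
  assumes L: "countable_lang L"
    and M: "is_structure L M" "finitely_generated L M" and N: "is_structure L N"
    and Sigma: "\<And>\<phi>. is_Sigma L 2 \<phi> \<Longrightarrow> fv \<phi> = {} \<Longrightarrow> holds M \<phi> \<Longrightarrow> holds N \<phi>"
  shows "\<exists>D. Sigma_elementary 1 L D N \<and> isomorphic L D M"
proof -
  obtain G where G: "finite G" "G \<subseteq> universe M" "generated L M G = universe M"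
    using M(2) by (auto simp: finitely_generated_def)
  obtain gs where gs: "set gs = G" using finite_list[OF G(1)] by blast
  obtain a where a: "a \<in> universe M" using M(1) by (auto simp: is_structure_def)
  define v where "v i = (if i < length gs then gs ! i else a)" for i
  have "v ` {..<length gs} = G" by (auto simp: v_def gs[symmetric] in_set_conv_nth)
  moreover have v: "range v \<subseteq> universe M" using G(2) a gs by (auto simp: v_def)
  moreover obtain w where "range w \<subseteq> universe N" "preserves_universal L (length gs) M v N w"
    using ex_preserves_universal[OF L v _ Sigma] N unfolding is_structure_def by blast
  ultimately show ?thesis using Sigma_elementary_copy[OF M(1) N] G(3) by metis
qed

section \<open>Preservation along elementary inclusions\<close>

text \<open>Wrapped in a one-member disjunction and an empty quantifier block, a quantifier-free
  formula is \<open>\<Sigma>\<^sub>1\<close> and goes down from \<open>C\<close> to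
  \<open>B\<close>; its negation going down gives the other direction.\<close>

lemma Sigma_elementary_sat_qfree:
  assumes E: "Sigma_elementary 1 L B C" and \<phi>: "qfree L \<phi>" and v: "range v \<subseteq> universe B"
  shows "sat B v \<phi> \<longleftrightarrow> sat C v \<phi>"
proof -
  have "sat B v \<psi>" if \<psi>: "qfree L \<psi>" "sat C v \<psi>" for \<psi>
  proof -
    have "is_Sigma L 1 (BigOr {0} (\<lambda>_. Exs [] \<psi>))"
      by (rule is_Sigma_is_Pi.Sigma_pos[where b = "\<lambda>_. 0"])
        (use \<psi> finite_fv_qfree in \<open>auto simp: is_Pi_0\<close>)
    moreover have "sat C v (BigOr {0} (\<lambda>_. Exs [] \<psi>))" using \<psi> by (simp add: Exs_def)
    ultimately have "sat B v (BigOr {0} (\<lambda>_. Exs [] \<psi>))"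
      using E v unfolding Sigma_elementary_def by blast
    then show ?thesis by (simp add: Exs_def)
  qed
  from this[of \<phi>] this[of "Neg \<phi>"] show ?thesis using \<phi> by (auto intro: qfree.intros)
qed

text \<open>Covers both levels, 0 and 1, that a matrix inside a level 2 formula may have.\<close>

lemma Sigma_elementary_Sigma_down:
  assumes E: "Sigma_elementary 1 L B C" and \<phi>: "is_Sigma L k \<phi>" "k < 2"
    and v: "range v \<subseteq> universe B" and C: "sat C v \<phi>"
  shows "sat B v \<phi>"
proof (cases "k = 0")
  case True
  then show ?thesis using Sigma_elementary_sat_qfree[OF E _ v] \<phi> C by (simp add: is_Sigma_0)
next
  case False
  then have "k = 1" using \<phi>(2) by simp
  then show ?thesis using E \<phi>(1) v C by (auto simp: Sigma_elementary_def)
qed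

lemma Sigma_elementary_Pi_up:
  assumes "Sigma_elementary 1 L B C" "is_Pi L k \<phi>" "k < 2" "range v \<subseteq> universe B" "sat B v \<phi>"
  shows "sat C v \<phi>"
  using Sigma_elementary_Sigma_down[OF assms(1) is_Sigma_dual[OF assms(2)] assms(3,4)] assms(5)
  by auto

text \<open>Witnesses in \<open>B\<close> remain witnesses in \<open>C\<close>, because the matrix
  below them has \<open>\<Pi>\<close> level 0 or 1 and such formulas go up.\<close>

lemma Sigma_elementary_Sigma_2_up:
  assumes E: "Sigma_elementary 1 L B C" and \<phi>: "is_Sigma L 2 \<phi>"
    and v: "range v \<subseteq> universe B" and B: "sat B v \<phi>"
  shows "sat C v \<phi>"
  using \<phi>
proof (cases rule: is_Sigma.cases)
  case (Sigma_pos I b \<Phi> xs)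
  then obtain i u where i: "i \<in> I" and u: "\<And>j. j \<notin> set (xs i) \<Longrightarrow> u j = v j"
    "u ` set (xs i) \<subseteq> universe B" "sat B u (\<Phi> i)"
    using B by (auto simp: sat_Exs)
  have "u j \<in> universe B" for j using u(1)[of j] u(2) v by (cases "j \<in> set (xs i)") auto
  then have "sat C u (\<Phi> i)" using Sigma_elementary_Pi_up[OF E _ _ _ u(3)] Sigma_pos i by blast
  moreover have "universe B \<subseteq> universe C"
    using E by (simp add: Sigma_elementary_def substructure_def)
  ultimately have "sat C v (Exs (xs i) (\<Phi> i))"
    unfolding sat_Exs using u by (intro exI[of _ u]) auto
  then show ?thesis using i Sigma_pos by auto
qed simp

lemma Sigma_elementary_Pi_2_down:
  assumes "Sigma_elementary 1 L B C" "is_Pi L 2 \<phi>" "range v \<subseteq> universe B" "sat C v \<phi>"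
  shows "sat B v \<phi>"
  using Sigma_elementary_Sigma_2_up[OF assms(1) is_Sigma_dual[OF assms(2)] assms(3)] assms(4)
  by auto

lemma is_model_Th_2_sandwich:
  assumes BA: "Sigma_elementary 1 L B A" and DB: "Sigma_elementary 1 L D B"
    and A: "is_structure L A" and iso: "isomorphic L D A"
  shows "is_model L B (Th 2 L A)"
proof -
  have str: "is_structure L D" "is_structure L B"
    using DB by (auto simp: Sigma_elementary_def substructure_def)
  have sub: "universe D \<subseteq> universe B" "universe B \<subseteq> universe A"
    using BA DB by (auto simp: Sigma_elementary_def substructure_def)
  have "holds B \<phi>" if \<phi>: "\<phi> \<in> Th 2 L A" for \<phi>
  proof (cases "is_Pi L 2 \<phi>")
    case True
    have "sat A v \<phi>" if "range v \<subseteq> universe B" for v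
      using \<phi> that sub(2) by (auto simp: Th_def holds_def)
    then show ?thesis
      using Sigma_elementary_Pi_2_down[OF BA True] by (auto simp: holds_def)
  next
    case False
    then have \<phi>': "is_Sigma L 2 \<phi>" "fv \<phi> = {}" "holds A \<phi>" using \<phi> by (auto simp: Th_def)
    have "holds D \<phi>"
      using holds_isomorphic[OF A isomorphic_sym[OF str(1) iso]] \<phi>' by blast
    \<comment> \<open>A sentence can be moved from \<open>D\<close> to \<open>B\<close> at one
      constant assignment.\<close>
    moreover obtain d where "d \<in> universe D" using str(1) by (auto simp: is_structure_def)
    ultimately have "sat D (\<lambda>_. d) \<phi>" "range (\<lambda>_::nat. d) \<subseteq> universe D" by (auto simp: holds_def)
    then have "sat B (\<lambda>_. d) \<phi>" using Sigma_elementary_Sigma_2_up[OF DB \<phi>'(1)] by blast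
    then show ?thesis by (rule holds_sentence[OF \<phi>'(2)])
  qed
  then show ?thesis using str(2) by (simp add: is_model_def)
qed

section \<open>The characterization\<close>

text \<open>The 2-theory decides every \<open>\<Sigma>\<^sub>2\<close> sentence: if one fails in
  \<open>A\<close>, its dual is a \<open>\<Pi>\<^sub>2\<close> sentence of the theory and so holds
  in \<open>M\<close>.\<close>

lemma holds_Sigma_2_of_model_Th_2:
  assumes A: "is_structure L A" and M: "is_model L M (Th 2 L A)"
    and \<phi>: "is_Sigma L 2 \<phi>" "fv \<phi> = {}" "holds M \<phi>"
  shows "holds A \<phi>"
proof (rule ccontr)
  assume "\<not> holds A \<phi>"
  then obtain v where "\<not> sat A v \<phi>" by (auto simp: holds_def)
  then have "holds A (dual \<phi>)" using \<phi>(2) by (intro holds_sentence) auto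
  then have "dual \<phi> \<in> Th 2 L A" using \<phi> by (auto simp: Th_def is_Pi_dual)
  then have "holds M (dual \<phi>)" using M by (auto simp: is_model_def)
  moreover obtain m where "m \<in> universe M" using M by (auto simp: is_model_def is_structure_def)
  ultimately show False using \<phi>(3) by (auto simp: holds_def)
qed

theorem theorem5p5:
  fixes L :: "('f, 'r) lang" and A :: "('a, 'f, 'r) struct"
  assumes "countable_lang L" and "is_structure L A" and "finitely_generated L A"
  shows "(\<exists>B. Sigma_elementary 1 L B A \<and> finitely_generated L B \<and> \<not> isomorphic L B A \<and>
            (\<exists>D. Sigma_elementary 1 L D B \<and> isomorphic L D A))
         \<longleftrightarrow> \<not> quasi_categorical L A"
proof
  assume "\<exists>B. Sigma_elementary 1 L B A \<and> finitely_generated L B \<and> \<not> isomorphic L B A \<and>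
            (\<exists>D. Sigma_elementary 1 L D B \<and> isomorphic L D A)"
  then obtain B D where B: "Sigma_elementary 1 L B A" "finitely_generated L B"
      "\<not> isomorphic L B A" "Sigma_elementary 1 L D B" "isomorphic L D A"
    by blast
  then have "is_model L B (Th 2 L A)" using is_model_Th_2_sandwich assms(2) by blast
  \<comment> \<open>Quasi-categoricity speaks of models on sets of natural numbers, while
    \<open>B\<close> lives in the type of \<open>A\<close>; its type-independent form applies to
    \<open>B\<close>.\<close>
  then show "\<not> quasi_categorical L A" using quasi_categorical_any[OF assms(1)] B by blast
next
  assume "\<not> quasi_categorical L A"
  then obtain M :: "(nat, 'f, 'r) struct" where
    M: "finitely_generated L M" "is_model L M (Th 2 L A)" "\<not> isomorphic L M A"
    by (auto simp: quasi_categorical_def)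
  have str_M: "is_structure L M" using M(2) by (simp add: is_model_def)
  \<comment> \<open>Every \<open>\<Sigma>\<^sub>2\<close> sentence true in \<open>M\<close> holds in
    \<open>A\<close>, so \<open>A\<close> contains an elementary copy \<open>B\<close> of
    \<open>M\<close>.\<close>
  obtain B where B: "Sigma_elementary 1 L B A" "isomorphic L B M"
    using ex_Sigma_elementary_copy[OF assms(1) str_M M(1) assms(2)]
      holds_Sigma_2_of_model_Th_2[OF assms(2) M(2)] by blast
  have str_B: "is_structure L B" using B(1) by (simp add: Sigma_elementary_def substructure_def)
  have MB: "isomorphic L M B" by (rule isomorphic_sym[OF str_B B(2)])
  \<comment> \<open>Being isomorphic to \<open>M\<close>, the structure \<open>B\<close> satisfies
    the \<open>\<Sigma>\<^sub>2\<close> sentences of \<open>A\<close>, so the same construction now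
    places a copy of \<open>A\<close> inside \<open>B\<close>.\<close>
  have "holds B \<phi>" if "is_Sigma L 2 \<phi>" "fv \<phi> = {}" "holds A \<phi>" for \<phi>
    using holds_isomorphic[OF str_M MB] that M(2) by (auto simp: is_model_def Th_def)
  then have "\<exists>D. Sigma_elementary 1 L D B \<and> isomorphic L D A"
    using ex_Sigma_elementary_copy[OF assms str_B] by blast
  moreover have "\<not> isomorphic L B A" using isomorphic_trans[OF MB] M(3) by blast
  ultimately show "\<exists>B. Sigma_elementary 1 L B A \<and> finitely_generated L B \<and>
      \<not> isomorphic L B A \<and> (\<exists>D. Sigma_elementary 1 L D B \<and> isomorphic L D A)"
    using B(1) finitely_generated_isomorphic[OF M(1) MB str_B] by blast
qed

end
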